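(* Let $P$ be a transition matrix on a countable state space $S$. For each $A\subseteq S$ there exist $\lambda_t(A),\lambda_r(A)\in[1,\infty]$ with $\lambda_t(A)\le\lambda_r(A)$ such that the following hold for each offspring distribution $\mu$ with mean $\bar\mu$: 1. If $\bar\mu<\lambda_t(A)$ then $A$ is $\mu$-transient. 2. If $\bar\mu>\lambda_t(A)$ then $A$ is not $\mu$-transient. 3. If $\bar\mu<\lambda_r(A)$ then $A$ is not $\mu$-recurrent. 4. If $\bar\mu>\lambda_r(A)$ then $A$ is $\mu$-recurrent.
   Context: $S$ is a countable (nonempty) set and $P$ is the transition matrix of a Markov chain on $S$. An offspring distribution is a probability measure $\mu$ on $\{0,1,2,\ldots\}$; its mean is $\bar\mu=\sum_{n\ge 0} n\mu(n)\in[0,\infty]$. The branching Markov process $(B_n)_{n\ge 0}$ associated to $(P,\mu)$ takes values in finitely supported functions $S\to\{0,1,2,\ldots\}$, where $B_n(y)$ is the number of particles at state $y$ at time $n$. It starts from a single particle at some $x\in S$. At each time step, each particle is independently replaced by a random number of new particles with law $\mu$, and each new particle immediately performs an independent step of the Markov chain with transition matrix $P$ from its parent's location. Its law is denoted $\mathbf{P}_x^\mu$. For $A\subseteq S$, $L(A)=\sum_{a\in A}\sum_{n\ge 0}B_n(a)\in[0,\infty]$ is the total number of particles that ever visit $A$. $\Omega_\infty$ is the event that the process survives forever, i.e. $\sum_{y\in S}B_n(y)>0$ for every $n$. A set $A\subseteq S$ is $\mu$-recurrent if for every $x\in S$ we have $\mathbf{P}_x^\mu(\Omega_\infty)>0$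 and $\mathbf{P}_x^\mu(L(A)=\infty\mid\Omega_\infty)=1$. A set $A\subseteq S$ is $\mu$-transient if $\mathbf{P}_x^\mu(L(A)=\infty)=0$ for every $x\in S$. *)

theory Defs
  imports "HOL-Probability.Probability" "HOL-Library.Multiset"
begin

text \<open>
  The state space is a type \<open>'a::countable\<close>, a transition matrix on it is a map
  \<open>P :: 'a \<Rightarrow> 'a pmf\<close> (row \<open>x\<close> is the distribution \<open>P x\<close>), and an offspring distribution is an
  element of \<open>nat pmf\<close>.  Finitely supported functions from the state space to the natural numbers
  are multisets: the number of particles at \<open>y\<close> in the configuration \<open>B\<close> is \<open>count B y\<close>.
\<close>

definition offspring_mean :: "nat pmf \<Rightarrow> ennreal" where
  "offspring_mean \<mu> = (\<Sum>n. of_nat n * ennreal (pmf \<mu> n))"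

text \<open>The children of one particle at \<open>x\<close>, after each of them has made its own \<open>P\<close>-step from \<open>x\<close>.\<close>

definition children :: "('a \<Rightarrow> 'a pmf) \<Rightarrow> nat pmf \<Rightarrow> 'a \<Rightarrow> 'a multiset pmf" where
  "children P \<mu> x = do {k \<leftarrow> \<mu>; xs \<leftarrow> replicate_pmf k (P x); return_pmf (mset xs)}"

definition add_children ::
  "('a \<Rightarrow> 'a pmf) \<Rightarrow> nat pmf \<Rightarrow> 'a \<Rightarrow> 'a multiset pmf \<Rightarrow> 'a multiset pmf" where
  "add_children P \<mu> x q = do {C \<leftarrow> children P \<mu> x; D \<leftarrow> q; return_pmf (C + D)}"

definition branching_step ::
  "('a \<Rightarrow> 'a pmf) \<Rightarrow> nat pmf \<Rightarrow> 'a multiset \<Rightarrow> 'a multiset pmf" where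
  "branching_step P \<mu> B = fold_mset (add_children P \<mu>) (return_pmf {#}) B"

text \<open>The fold does not depend on the order in which particles are treated:\<close>

lemma comp_fun_commute_add_children: "comp_fun_commute (add_children P \<mu>)"
proof
  fix x y
  have "add_children P \<mu> y (add_children P \<mu> x q) = add_children P \<mu> x (add_children P \<mu> y q)" for q
    unfolding add_children_def bind_assoc_pmf bind_return_pmf
    by (subst bind_commute_pmf) (simp add: add.left_commute)
  then show "add_children P \<mu> y \<circ> add_children P \<mu> x = add_children P \<mu> x \<circ> add_children P \<mu> y"
    by auto
qed

lemma branching_step_empty: "branching_step P \<mu> {#} = return_pmf {#}"
  by (simp add: branching_step_def)

lemma branching_step_add_mset:
  "branching_step P \<mu> (add_mset x B) =
     do {C \<leftarrow> children P \<mu> x; D \<leftarrow> branching_step P \<mu> B; return_pmf (C + D)}"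
proof -
  interpret comp_fun_commute "add_children P \<mu>" by (rule comp_fun_commute_add_children)
  show ?thesis by (simp add: branching_step_def add_children_def)
qed

text \<open>
  The law of the process started from a single particle at \<open>x\<close>, as a measure on trajectories
  \<open>nat \<Rightarrow> 'a multiset\<close> with the product sigma-algebra, by the Ionescu-Tulcea construction.
  The lemmas that follow the definition identify its finite-dimensional distributions.
\<close>

definition branching_kernel ::
  "('a \<Rightarrow> 'a pmf) \<Rightarrow> nat pmf \<Rightarrow> 'a \<Rightarrow> nat \<Rightarrow> (nat \<Rightarrow> 'a multiset) \<Rightarrow> 'a multiset measure" where
  "branching_kernel P \<mu> x n \<omega> =
     measure_pmf (case n of 0 \<Rightarrow> return_pmf {#x#} | Suc m \<Rightarrow> branching_step P \<mu> (\<omega> m))"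

definition branching_law ::
  "('a::countable \<Rightarrow> 'a pmf) \<Rightarrow> nat pmf \<Rightarrow> 'a \<Rightarrow> (nat \<Rightarrow> 'a multiset) measure" where
  "branching_law P \<mu> x =
     projective_family.lim UNIV
       (Ionescu_Tulcea.CI (branching_kernel P \<mu> x) (\<lambda>_. count_space UNIV)) (\<lambda>_. count_space UNIV)"

lemma Ionescu_Tulcea_branching:
  fixes P :: "'a::countable \<Rightarrow> 'a pmf"
  shows "Ionescu_Tulcea (branching_kernel P \<mu> x) (\<lambda>_. count_space UNIV)"
proof (rule Ionescu_Tulcea.intro)
  fix n :: nat
  show "branching_kernel P \<mu> x n \<in>
    measurable (Pi\<^sub>M {0..<n} (\<lambda>_. count_space UNIV)) (subprob_algebra (count_space UNIV))"
  proof (cases n)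
    case 0
    then show ?thesis
      by (auto simp: branching_kernel_def[abs_def] space_subprob_algebra
            intro!: measurable_const prob_space_imp_subprob_space measure_pmf.prob_space_axioms)
  next
    case (Suc m)
    have 1: "(\<lambda>\<omega>. \<omega> m) \<in> measurable (Pi\<^sub>M {0..<n} (\<lambda>_. count_space UNIV)) (count_space UNIV)"
      by (rule measurable_component_singleton) (simp add: Suc)
    have 2: "(\<lambda>B. measure_pmf (branching_step P \<mu> B)) \<in>
        measurable (count_space UNIV) (subprob_algebra (count_space UNIV))"
      by (auto simp: space_subprob_algebra
            intro!: prob_space_imp_subprob_space measure_pmf.prob_space_axioms)
    show ?thesis
      using measurable_compose[OF 1 2] by (simp add: branching_kernel_def[abs_def] Suc)
  qed
qed (simp add: branching_kernel_def measure_pmf.prob_space_axioms)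

lemma sets_branching_law:
  "sets (branching_law P \<mu> x) = sets (Pi\<^sub>M UNIV (\<lambda>_. count_space UNIV))"
proof -
  interpret Ionescu_Tulcea "branching_kernel P \<mu> x" "\<lambda>_. count_space UNIV"
    by (rule Ionescu_Tulcea_branching)
  show ?thesis by (simp add: branching_law_def)
qed

lemma prob_space_branching_law: "prob_space (branching_law P \<mu> x)"
proof -
  interpret Ionescu_Tulcea "branching_kernel P \<mu> x" "\<lambda>_. count_space UNIV"
    by (rule Ionescu_Tulcea_branching)
  have "prob_space (distr PF.lim (Pi\<^sub>M {} (\<lambda>_. count_space UNIV)) (\<lambda>f. restrict f {}))"
    by (subst distr_lim) (simp_all add: PF.prob_space_P)
  moreover have "(\<lambda>f. restrict f {}) \<in> measurable PF.lim (Pi\<^sub>M {} (\<lambda>_. count_space UNIV))"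
    unfolding measurable_cong_sets[OF PF.sets_lim refl] by (rule measurable_restrict_subset) simp
  ultimately show ?thesis
    unfolding branching_law_def by (rule prob_space_distrD[rotated])
qed

lemma emeasure_branching_law_cylinder:
  fixes P :: "'a::countable \<Rightarrow> 'a pmf"
  shows "emeasure (branching_law P \<mu> x) {\<omega>. \<forall>i\<le>n. \<omega> i = b i} =
    indicator {{#x#}} (b 0) * (\<Prod>i<n. ennreal (pmf (branching_step P \<mu> (b i)) (b (Suc i))))"
proof -
  let ?M = "\<lambda>_::nat. count_space (UNIV :: 'a multiset set)"
  interpret Ionescu_Tulcea "branching_kernel P \<mu> x" ?M
    by (rule Ionescu_Tulcea_branching)
  define Z where "Z n = {\<omega> \<in> space (Pi\<^sub>M {0..<n} ?M). \<forall>i<n. \<omega> i = b i}" for n :: nat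
  have Z: "Z n = Pi\<^sub>E {0..<n} (\<lambda>i. {b i})" for n
    by (auto simp: Z_def space_PiM PiE_iff extensional_def)
  have Z_sets [measurable]: "Z n \<in> sets (Pi\<^sub>M {0..<n} ?M)" for n
    unfolding Z by (rule sets_PiM_I_finite) auto
  have C: "emeasure (C 0 (Suc n) (\<lambda>_. undefined)) (Z (Suc n)) =
    indicator {{#x#}} (b 0) * (\<Prod>i<n. ennreal (pmf (branching_step P \<mu> (b i)) (b (Suc i))))" for n
  proof (induction n)
    case 0
    have u: "(\<lambda>_. undefined) \<in> space (Pi\<^sub>M {0..<0} ?M)"
      by (simp add: space_PiM)
    have "emeasure (C 0 (Suc 0) (\<lambda>_. undefined)) (Z (Suc 0)) =
        emeasure (eP 0 (\<lambda>_. undefined)) (Z (Suc 0))"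
      using u bind_return[OF measurable_eP[of 0]] by simp
    also have "\<dots> = emeasure (branching_kernel P \<mu> x 0 (\<lambda>_. undefined)) {b 0}"
      by (subst emeasure_eP[OF u Z_sets])
         (auto simp: Z_def space_PiM branching_kernel_def PiE_iff extensional_def
            intro!: arg_cong[where f="emeasure _"])
    also have "\<dots> = indicator {{#x#}} (b 0)"
      by (simp add: branching_kernel_def emeasure_pmf_single indicator_def)
    finally show ?case
      by (simp del: C.simps)
  next
    case (Suc n)
    have u: "(\<lambda>_. undefined) \<in> space (Pi\<^sub>M {0..<0} ?M)"
      by (simp add: space_PiM)
    have "emeasure (C 0 (Suc (Suc n)) (\<lambda>_. undefined)) (Z (Suc (Suc n))) =
       (\<integral>\<^sup>+\<omega>. emeasure (eP (Suc n) \<omega>) (Z (Suc (Suc n))) \<partial>C 0 (Suc n) (\<lambda>_. undefined))"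
    proof -
      have "eP (Suc n) \<in> measurable (C 0 (Suc n) (\<lambda>_. undefined))
          (subprob_algebra (Pi\<^sub>M {0..<Suc (Suc n)} ?M))"
        unfolding measurable_cong_sets[OF sets_C[OF u, of "Suc n"] refl] add_0
        by (rule measurable_eP)
      moreover have "space (C 0 (Suc n) (\<lambda>_. undefined)) \<noteq> {}"
        using prob_space.not_empty[OF prob_space_C[OF u]] .
      ultimately show ?thesis
        using Z_sets[of "Suc (Suc n)"] by (subst C.simps) (simp del: C.simps add: emeasure_bind)
    qed
    also have "\<dots> = (\<integral>\<^sup>+\<omega>. ennreal (pmf (branching_step P \<mu> (b n)) (b (Suc n))) * indicator (Z (Suc n)) \<omega>
        \<partial>C 0 (Suc n) (\<lambda>_. undefined))"
    proof (rule nn_integral_cong)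
      fix \<omega> assume "\<omega> \<in> space (C 0 (Suc n) (\<lambda>_. undefined))"
      then have \<omega>: "\<omega> \<in> space (Pi\<^sub>M {0..<Suc n} ?M)"
        using space_C[OF u, of "Suc n"] by simp
      have "emeasure (eP (Suc n) \<omega>) (Z (Suc (Suc n))) =
        emeasure (measure_pmf (branching_step P \<mu> (\<omega> n))) {y. fun_upd \<omega> (Suc n) y \<in> Z (Suc (Suc n))}"
        by (subst emeasure_eP[OF \<omega> Z_sets])
           (auto simp: branching_kernel_def intro!: arg_cong[where f="emeasure _"])
      also have "{y. fun_upd \<omega> (Suc n) y \<in> Z (Suc (Suc n))} = (if \<omega> \<in> Z (Suc n) then {b (Suc n)} else {})"
        using \<omega> by (auto simp: Z_def space_PiM PiE_iff extensional_def less_Suc_eq)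
      finally show "emeasure (eP (Suc n) \<omega>) (Z (Suc (Suc n))) =
        ennreal (pmf (branching_step P \<mu> (b n)) (b (Suc n))) * indicator (Z (Suc n)) \<omega>"
        by (auto simp: emeasure_pmf_single Z_def split: if_splits)
    qed
    also have "\<dots> = ennreal (pmf (branching_step P \<mu> (b n)) (b (Suc n))) *
        emeasure (C 0 (Suc n) (\<lambda>_. undefined)) (Z (Suc n))"
      using sets_C[OF u, of "Suc n"] Z_sets[of "Suc n"] by (subst nn_integral_cmult_indicator) auto
    finally show ?case
      by (simp only: Suc.IH lessThan_Suc prod.insert[OF finite_lessThan] lessThan_iff less_irrefl
            not_False_eq_True ac_simps)
  qed
  have "{\<omega>. \<forall>i\<le>n. \<omega> i = b i} = PF.emb UNIV {0..<Suc n} (Z (Suc n))"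
    by (auto simp: prod_emb_def Z_def space_PiM less_Suc_eq_le)
  then have "emeasure (branching_law P \<mu> x) {\<omega>. \<forall>i\<le>n. \<omega> i = b i} =
      emeasure (CI {0..<Suc n}) (Z (Suc n))"
    unfolding branching_law_def by (simp only: lim[OF finite_atLeastLessThan Z_sets])
  also have "\<dots> = emeasure (C 0 (Suc n) (\<lambda>_. undefined)) (PF.emb {0..<Suc n} {0..<Suc n} (Z (Suc n)))"
    by (rule emeasure_CI[OF order_refl Z_sets])
  also have "PF.emb {0..<Suc n} {0..<Suc n} (Z (Suc n)) = Z (Suc n)"
    by (rule prod_emb_id) (auto simp: Z)
  finally show ?thesis
    by (simp only: C)
qed

definition total_visits :: "'a set \<Rightarrow> (nat \<Rightarrow> 'a multiset) \<Rightarrow> ennreal" where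
  "total_visits A B = (\<integral>\<^sup>+a. (\<Sum>n. of_nat (count (B n) a)) \<partial>count_space A)"

definition survives :: "(nat \<Rightarrow> 'a multiset) \<Rightarrow> bool" where
  "survives B \<longleftrightarrow> (\<forall>n. size (B n) > 0)"

lemma measurable_total_visits:
  fixes A :: "'a::countable set"
  shows "total_visits A \<in> borel_measurable (branching_law P \<mu> x)"
proof -
  have [measurable]:
    "(\<lambda>B. of_nat (count (B n) a) :: ennreal) \<in> borel_measurable (branching_law P \<mu> x)" for n a
    unfolding measurable_cong_sets[OF sets_branching_law refl]
    by (rule measurable_compose[OF measurable_component_singleton[OF UNIV_I]]) simp
  have eq: "total_visits A B =
      (\<Sum>i. (\<Sum>n. of_nat (count (B n) (from_nat i))) * indicator (to_nat ` A) i)" for B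
  proof -
    have "total_visits A B = (\<integral>\<^sup>+a. (\<Sum>n. of_nat (count (B n) (from_nat (to_nat a)))) \<partial>count_space A)"
      by (simp add: total_visits_def)
    also have "\<dots> = (\<integral>\<^sup>+i. (\<Sum>n. of_nat (count (B n) (from_nat i))) \<partial>count_space (to_nat ` A))"
      by (rule nn_integral_bij_count_space) (simp add: bij_betw_def)
    also have "\<dots> = (\<integral>\<^sup>+i. (\<Sum>n. of_nat (count (B n) (from_nat i))) * indicator (to_nat ` A) i \<partial>count_space UNIV)"
      by (simp add: nn_integral_count_space_indicator)
    finally show ?thesis
      by (simp add: nn_integral_count_space_nat)
  qed
  show ?thesis unfolding eq[abs_def] by measurable
qed

lemma pred_survives: "Measurable.pred (branching_law P \<mu> x) survives"
proof -
  have [measurable]: "Measurable.pred (branching_law P \<mu> x) (\<lambda>B. size (B n) > 0)" for n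
    unfolding measurable_cong_sets[OF sets_branching_law refl]
    by (rule measurable_compose[OF measurable_component_singleton[OF UNIV_I]]) simp
  show ?thesis unfolding survives_def[abs_def] by measurable
qed

definition recurrent_set :: "('a::countable \<Rightarrow> 'a pmf) \<Rightarrow> nat pmf \<Rightarrow> 'a set \<Rightarrow> bool" where
  "recurrent_set P \<mu> A \<longleftrightarrow>
     (\<forall>x. \<P>(B in branching_law P \<mu> x. survives B) > 0 \<and>
          \<P>(B in branching_law P \<mu> x. total_visits A B = \<infinity> \<bar> survives B) = 1)"

definition transient_set :: "('a::countable \<Rightarrow> 'a pmf) \<Rightarrow> nat pmf \<Rightarrow> 'a set \<Rightarrow> bool" where
  "transient_set P \<mu> A \<longleftrightarrow> (\<forall>x. \<P>(B in branching_law P \<mu> x. total_visits A B = \<infinity>) = 0)"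

end

theory Submission
  imports Defs
begin

text \<open>
  Mark every child of a particle independently with probability \<open>t\<close>, and let \<open>g\<^sub>\<mu>(t)\<close> be the
  probability that some child is marked.  This function is concave on \<open>[0,1]\<close>, vanishes at \<open>0\<close>
  and has the (possibly infinite) slope \<open>offspring_mean \<mu>\<close> there.  Hence, if \<open>\<mu>\<close> has a smaller
  mean than \<open>\<nu>\<close>, then \<open>g\<^sub>\<mu> \<le> g\<^sub>\<nu>\<close> on some interval \<open>[0,\<epsilon>]\<close> (\<open>mean_less_imp_germ\<close>), although the
  order may be reversed at larger arguments.

  The branching property turns hitting probabilities into iterates of \<open>g\<close>: outside the target,
  the probability of hitting it equals \<open>g\<^sub>\<mu>\<close> applied to the average, over one step of \<open>P\<close>, of the
  probability of hitting it from there.  Since \<open>c g\<^sub>\<mu>(t) \<le> g\<^sub>\<mu>(c t)\<close> for \<open>c \<le> 1\<close> by concavity,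
  hitting probabilities for \<open>\<mu>\<close> can be multiplied by \<open>\<epsilon>\<close>, which moves all arguments into the
  interval on which \<open>g\<^sub>\<mu> \<le> g\<^sub>\<nu>\<close>; an induction on the time horizon then shows that \<open>\<epsilon>\<close> times a
  hitting probability for \<open>\<mu>\<close> is at most the one for \<open>\<nu>\<close> (\<open>hit_prob_comparison\<close>).  In the limit
  the same holds for the probability of infinitely many visits.  So a set that is not
  \<open>\<mu>\<close>-transient is not \<open>\<nu>\<close>-transient.

  If \<open>A\<close> is \<open>\<mu>\<close>-recurrent, the comparison bounds the \<open>\<nu>\<close>-probability of infinitely many visits
  below by a positive constant that does not depend on the starting point.  When \<open>\<nu>\<close> has mean
  above 1, this bound improves itself: let \<open>q > 0\<close> be the infimum, over all starting
  points and all \<open>n\<close>, of the probability of a visit at time \<open>n\<close> or later.  One step of the process gives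
  \<open>g\<^sub>\<nu>(q) \<le> q\<close>, while the survival probability \<open>s\<close> satisfies \<open>g\<^sub>\<nu>(s) = s\<close>.  A concave function
  with \<open>g\<^sub>\<nu>(t) > t\<close> near \<open>0\<close> cannot be on or below the diagonal at \<open>q\<close> and on it again at some
  \<open>s > q\<close>, so \<open>q \<ge> s\<close>, and \<open>A\<close> is \<open>\<nu>\<close>-recurrent (\<open>recurrent_set_if_infinite_visit_prob_ge\<close>).

  Both properties are thus monotone in the mean, and the thresholds are the infima of the means
  of the offspring distributions for which \<open>A\<close> is not transient, respectively recurrent.  They are
  at least 1 because a process with mean below 1 dies out.
\<close>

section \<open>The probability that some child is marked\<close>

lemma integrable_pmf_unit_interval:
  fixes f :: "'b \<Rightarrow> real"
  assumes "\<And>x. 0 \<le> f x" "\<And>x. f x \<le> 1"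
  shows "integrable (measure_pmf p) f"
  using assms by (intro measure_pmf.integrable_const_bound[where B = 1]) auto

lemma expectation_unit_interval:
  fixes f :: "'b \<Rightarrow> real"
  assumes "\<And>x. 0 \<le> f x" "\<And>x. f x \<le> 1"
  shows "0 \<le> measure_pmf.expectation p f" "measure_pmf.expectation p f \<le> 1"
  using assms measure_pmf.integral_le_const[of p f 1] integrable_pmf_unit_interval[of f p]
  by (auto intro: integral_nonneg)

lemma nn_integral_unit_interval:
  fixes f :: "'b \<Rightarrow> real"
  assumes "\<And>x. 0 \<le> f x" "\<And>x. f x \<le> 1"
  shows "(\<integral>\<^sup>+x. ennreal (f x) \<partial>measure_pmf p) = ennreal (measure_pmf.expectation p f)"
  using assms by (intro nn_integral_eq_integral integrable_pmf_unit_interval) auto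

lemma expectation_bind_pmf:
  fixes f :: "'b \<Rightarrow> real"
  assumes "\<And>x. 0 \<le> f x" "\<And>x. f x \<le> 1"
  shows "measure_pmf.expectation (bind_pmf p q) f =
    measure_pmf.expectation p (\<lambda>x. measure_pmf.expectation (q x) f)"
proof -
  have "ennreal (measure_pmf.expectation (bind_pmf p q) f) =
      (\<integral>\<^sup>+x. ennreal (measure_pmf.expectation (q x) f) \<partial>p)"
    by (simp add: nn_integral_unit_interval[of f, OF assms, symmetric])
  also have "\<dots> = ennreal (measure_pmf.expectation p (\<lambda>x. measure_pmf.expectation (q x) f))"
    using expectation_unit_interval[OF assms] by (intro nn_integral_unit_interval)
  finally show ?thesis
    using assms by (subst (asm) ennreal_inj) (auto intro!: expectation_unit_interval)
qed

text \<open>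
  In terms of the probability generating function \<open>f\<close> of \<open>\<mu>\<close> this is \<open>1 - f (1 - t)\<close>.
\<close>

definition mark_prob :: "nat pmf \<Rightarrow> real \<Rightarrow> real" where
  "mark_prob \<mu> t = measure_pmf.expectation \<mu> (\<lambda>n. 1 - (1 - t) ^ n)"

lemma one_minus_power_unit_interval:
  fixes t :: real
  assumes "0 \<le> t" "t \<le> 1"
  shows "0 \<le> 1 - (1 - t) ^ n" "1 - (1 - t) ^ n \<le> 1"
  using assms by (auto simp: power_le_one)

lemma integrable_mark:
  assumes "0 \<le> t" "t \<le> (1::real)"
  shows "integrable (measure_pmf \<mu>) (\<lambda>n. 1 - (1 - t) ^ n)"
  using one_minus_power_unit_interval[OF assms] by (rule integrable_pmf_unit_interval)

lemma mark_prob_unit_interval: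
  assumes "0 \<le> t" "t \<le> 1"
  shows "0 \<le> mark_prob \<mu> t" "mark_prob \<mu> t \<le> 1"
  unfolding mark_prob_def using one_minus_power_unit_interval[OF assms]
  by (rule expectation_unit_interval)+

lemma mark_prob_0 [simp]: "mark_prob \<mu> 0 = 0"
  by (simp add: mark_prob_def)

lemma mark_prob_mono:
  assumes "0 \<le> s" "s \<le> t" "t \<le> 1"
  shows "mark_prob \<mu> s \<le> mark_prob \<mu> t"
  unfolding mark_prob_def using assms
  by (intro integral_mono integrable_mark) (auto intro: power_mono)

text \<open>
  Pointwise in the number \<open>n\<close> of children, \<open>(1 - t) ^ n\<close> is convex in \<open>t\<close>.
\<close>

lemma concave_on_mark_prob: "concave_on {0..1} (mark_prob \<mu>)"
proof -
  have cv: "convex_on {0..} (\<lambda>x::real. x ^ n)" for n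
    by (cases "even n") (auto intro: convex_power_odd convex_on_subset[OF convex_power_even])
  have "u * mark_prob \<mu> s + v * mark_prob \<mu> t \<le> mark_prob \<mu> (u * s + v * t)"
    if "0 \<le> s" "s \<le> 1" "0 \<le> t" "t \<le> 1" and uv: "0 \<le> u" "0 \<le> v" "u + v = 1" for s t u v
  proof -
    have mix: "0 \<le> u * s + v * t" "u * s + v * t \<le> 1"
      using that convex_bound_le[of s 1 t u v] by auto
    have "u * mark_prob \<mu> s + v * mark_prob \<mu> t =
        measure_pmf.expectation \<mu> (\<lambda>n. u * (1 - (1 - s) ^ n) + v * (1 - (1 - t) ^ n))"
      unfolding mark_prob_def using that by (simp add: integrable_mark)
    also have "\<dots> \<le> measure_pmf.expectation \<mu> (\<lambda>n. 1 - (1 - (u * s + v * t)) ^ n)"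
    proof (intro integral_mono integrable_mark mix)
      show "integrable (measure_pmf \<mu>) (\<lambda>n. u * (1 - (1 - s) ^ n) + v * (1 - (1 - t) ^ n))"
        using that by (intro Bochner_Integration.integrable_add integrable_mult_right integrable_mark)
      fix n
      have "1 - (u * s + v * t) = u * (1 - s) + v * (1 - t)"
        using uv by (simp add: algebra_simps)
      moreover have "(u * (1 - s) + v * (1 - t)) ^ n \<le> u * (1 - s) ^ n + v * (1 - t) ^ n"
        using cv[of n] that unfolding convex_on_def by auto
      ultimately have "(1 - (u * s + v * t)) ^ n \<le> u * (1 - s) ^ n + v * (1 - t) ^ n"
        by simp
      moreover have "u * (1 - (1 - s) ^ n) + v * (1 - (1 - t) ^ n) =
          (u + v) - (u * (1 - s) ^ n + v * (1 - t) ^ n)"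
        by (simp add: algebra_simps)
      ultimately show "u * (1 - (1 - s) ^ n) + v * (1 - (1 - t) ^ n) \<le> 1 - (1 - (u * s + v * t)) ^ n"
        using uv by simp
    qed
    finally show ?thesis by (simp add: mark_prob_def)
  qed
  then show ?thesis by (auto simp: concave_on_iff)
qed

lemma mark_prob_scale:
  assumes "0 \<le> c" "c \<le> 1" "0 \<le> t" "t \<le> 1"
  shows "c * mark_prob \<mu> t \<le> mark_prob \<mu> (c * t)"
proof -
  have "(1 - c) * mark_prob \<mu> 0 + c * mark_prob \<mu> t \<le> mark_prob \<mu> ((1 - c) *\<^sub>R 0 + c *\<^sub>R t)"
    using assms by (intro concave_onD[OF concave_on_mark_prob]) auto
  then show ?thesis by simp
qed

lemma mark_prob_tendsto:
  assumes "X \<longlonglongrightarrow> t" "\<And>k. 0 \<le> X k" "\<And>k. X k \<le> 1"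
  shows "(\<lambda>k. mark_prob \<mu> (X k)) \<longlonglongrightarrow> mark_prob \<mu> t"
  unfolding mark_prob_def
proof (rule integral_dominated_convergence[where w = "\<lambda>_. 1"])
  show "AE n in measure_pmf \<mu>. (\<lambda>k. 1 - (1 - X k) ^ n) \<longlonglongrightarrow> 1 - (1 - t) ^ n"
    using assms(1) by (auto intro!: tendsto_intros)
  show "AE n in measure_pmf \<mu>. norm (1 - (1 - X k) ^ n) \<le> 1" for k
    using one_minus_power_unit_interval[OF assms(2,3)] by auto
qed auto

lemma offspring_mean_eq_nn_integral: "offspring_mean \<mu> = (\<integral>\<^sup>+n. of_nat n \<partial>measure_pmf \<mu>)"
  unfolding offspring_mean_def nn_integral_measure_pmf nn_integral_count_space_nat
  by (simp add: mult.commute)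

text \<open>
  Union bound: the expected number of marked children is the mean times \<open>t\<close>.
\<close>

lemma mark_prob_le_mean:
  assumes m: "offspring_mean \<mu> \<le> ennreal m" and t: "0 \<le> t" "t \<le> 1" and "0 \<le> m"
  shows "mark_prob \<mu> t \<le> m * t"
proof -
  have "ennreal (mark_prob \<mu> t) = (\<integral>\<^sup>+n. ennreal (1 - (1 - t) ^ n) \<partial>measure_pmf \<mu>)"
    unfolding mark_prob_def using one_minus_power_unit_interval[OF t]
    by (rule nn_integral_unit_interval[symmetric])
  also have "\<dots> \<le> (\<integral>\<^sup>+n. of_nat n * ennreal t \<partial>measure_pmf \<mu>)"
  proof (rule nn_integral_mono)
    fix n
    have "1 - (1 - t) ^ n \<le> real n * t"
      using Bernoulli_inequality[of "- t" n] t by simp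
    then show "ennreal (1 - (1 - t) ^ n) \<le> of_nat n * ennreal t"
      using t by (simp add: ennreal_of_nat_eq_real_of_nat ennreal_mult'[symmetric] ennreal_leI)
  qed
  also have "\<dots> = offspring_mean \<mu> * ennreal t"
    by (simp add: offspring_mean_eq_nn_integral nn_integral_multc)
  also have "\<dots> \<le> ennreal m * ennreal t"
    using m by (intro mult_right_mono) auto
  finally show ?thesis
    using t \<open>0 \<le> m\<close> by (simp add: ennreal_mult'[symmetric])
qed

text \<open>
  Together with \<open>mark_prob_le_mean\<close> this says that the slope at 0 is the mean.  Infinite means are
  included because only a partial sum exceeding \<open>m\<close> is used.
\<close>

lemma mark_prob_ge_near_0:
  assumes m: "ennreal m < offspring_mean \<nu>" and "0 \<le> m"
  obtains \<epsilon> where "0 < \<epsilon>" "\<epsilon> \<le> 1" "\<And>t. 0 \<le> t \<Longrightarrow> t \<le> \<epsilon> \<Longrightarrow> m * t \<le> mark_prob \<nu> t"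
proof -
  obtain N where N: "ennreal m < (\<Sum>n<N. of_nat n * ennreal (pmf \<nu> n))"
    using m unfolding offspring_mean_def suminf_eq_SUP less_SUP_iff by auto
  define S where "S = (\<Sum>n<N. real n * pmf \<nu> n)"
  have "(\<Sum>n<N. of_nat n * ennreal (pmf \<nu> n)) = ennreal S"
    unfolding S_def
    by (simp add: sum_ennreal[symmetric] ennreal_mult' ennreal_of_nat_eq_real_of_nat del: sum_ennreal)
  then have mS: "m < S"
    using N \<open>0 \<le> m\<close> by (simp add: ennreal_less_iff)
  then have "0 < S" using \<open>0 \<le> m\<close> by simp
  \<comment> \<open>Chosen such that \<open>m \<le> S * (1 - t) ^ N\<close> for \<open>t \<le> \<epsilon>\<close>; \<open>N + 1\<close> avoids a division by 0.\<close>
  define \<epsilon> where "\<epsilon> = min 1 ((S - m) / (S * (N + 1)))"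
  have "m * t \<le> mark_prob \<nu> t" if t: "0 \<le> t" "t \<le> \<epsilon>" for t
  proof -
    have t1: "t \<le> 1" using t by (simp add: \<epsilon>_def)
    have "t \<le> (S - m) / (S * (N + 1))" using t by (simp add: \<epsilon>_def)
    then have "t * (S * (N + 1)) \<le> S - m"
      using \<open>0 < S\<close> by (simp add: pos_le_divide_eq)
    then have "m \<le> S * (1 - N * t)"
      using \<open>0 < S\<close> t by (simp add: algebra_simps) (smt (verit) mult_nonneg_nonneg)
    also have "\<dots> \<le> S * (1 - t) ^ N"
      using Bernoulli_inequality[of "- t" N] t1 \<open>0 < S\<close> by (intro mult_left_mono) auto
    finally have "m * t \<le> S * (1 - t) ^ N * t"
      using t by (intro mult_right_mono) auto
    also have "\<dots> = (\<Sum>n<N. (real n * (1 - t) ^ N * t) * pmf \<nu> n)"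
      by (simp add: S_def sum_distrib_right sum_distrib_left mult_ac)
    also have "\<dots> \<le> (\<Sum>n<N. (1 - (1 - t) ^ n) * pmf \<nu> n)"
    proof (intro sum_mono mult_right_mono)
      fix n assume "n \<in> {..<N}"
      then have "(\<Sum>i<n. (1 - t) ^ N) \<le> (\<Sum>i<n. (1 - t) ^ i)"
        using t t1 by (intro sum_mono power_decreasing) auto
      then have "real n * (1 - t) ^ N \<le> (\<Sum>i<n. (1 - t) ^ i)"
        by simp
      then have "real n * (1 - t) ^ N * t \<le> t * (\<Sum>i<n. (1 - t) ^ i)"
        using t by (simp add: mult.commute mult_left_mono)
      also have "\<dots> = 1 - (1 - t) ^ n"
        using one_diff_power_eq[of "1 - t" n] by simp
      finally show "real n * (1 - t) ^ N * t \<le> 1 - (1 - t) ^ n" .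
    qed simp
    also have "\<dots> = (\<Sum>n<N. (1 - (1 - t) ^ n) * indicator {..<N} n * pmf \<nu> n)"
      by (intro sum.cong) auto
    also have "\<dots> = measure_pmf.expectation \<nu> (\<lambda>n. (1 - (1 - t) ^ n) * indicator {..<N} n)"
      by (subst integral_measure_pmf_real[where A = "{..<N}"]) (auto simp: indicator_def)
    also have "\<dots> \<le> mark_prob \<nu> t"
      unfolding mark_prob_def using one_minus_power_unit_interval[OF t(1) t1]
      by (intro integral_mono integrable_pmf_unit_interval) (auto simp: indicator_def)
    finally show ?thesis .
  qed
  moreover have "0 < \<epsilon>" "\<epsilon> \<le> 1"
    using mS \<open>0 < S\<close> by (auto simp: \<epsilon>_def)
  ultimately show thesis using that by blast
qed

text \<open>
  Otherwise \<open>q\<close> would lie strictly between a small \<open>t\<close>, where the graph is strictly above the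
  diagonal, and \<open>s\<close>, where it is not below it; by concavity it would be strictly above at \<open>q\<close>.
\<close>

lemma mark_prob_supersolution_ge_subsolution:
  assumes near_0: "0 < \<epsilon>" "1 < m" "\<And>t. 0 \<le> t \<Longrightarrow> t \<le> \<epsilon> \<Longrightarrow> m * t \<le> mark_prob \<nu> t"
    and q: "0 < q" "mark_prob \<nu> q \<le> q" and s: "s \<le> 1" "s \<le> mark_prob \<nu> s"
  shows "s \<le> q"
proof (rule ccontr)
  assume "\<not> s \<le> q"
  then have qs: "q < s" by simp
  define t where "t = min \<epsilon> (q / 2)"
  have t: "0 < t" "t \<le> \<epsilon>" "t < q"
    using near_0(1) q(1) by (auto simp: t_def)
  have "t < m * t" using t near_0(2) by simp
  also have "\<dots> \<le> mark_prob \<nu> t" using near_0(3) t by simp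
  finally have gt: "t < mark_prob \<nu> t" .
  define u where "u = (q - t) / (s - t)"
  have u: "0 < u" "u < 1" using t qs by (auto simp: u_def)
  have "u * (s - t) = q - t" using t qs by (simp add: u_def)
  then have mix: "q = (1 - u) * t + u * s" by (simp add: algebra_simps)
  then have "q < (1 - u) * mark_prob \<nu> t + u * mark_prob \<nu> s"
    using u gt s(2) by (intro order.strict_trans1[OF eq_refl[OF mix]] add_less_le_mono) auto
  also have "\<dots> \<le> mark_prob \<nu> ((1 - u) *\<^sub>R t + u *\<^sub>R s)"
    using u t qs s(1) by (intro concave_onD[OF concave_on_mark_prob]) auto
  also have "\<dots> = mark_prob \<nu> q" using mix by simp
  finally show False using q(2) by simp
qed

section \<open>Finite trajectories and the branching property\<close>

text \<open>
  The branching property for one step: particles reproduce independently, so a functional that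
  multiplies over the particles stays of this form.
\<close>

lemma expectation_prod_mset_branching_step:
  fixes r :: "'a \<Rightarrow> real"
  assumes r: "\<And>x. 0 \<le> r x" "\<And>x. r x \<le> 1"
  shows "measure_pmf.expectation (branching_step P \<mu> B) (\<lambda>C. \<Prod>y\<in>#C. r y) =
    (\<Prod>x\<in>#B. 1 - mark_prob \<mu> (1 - measure_pmf.expectation (P x) r))"
proof -
  have prod_ge: "0 \<le> (\<Prod>y\<in>#C. r y)" for C
    using r by (induction C) auto
  have prod_le: "(\<Prod>y\<in>#C. r y) \<le> 1" for C
    using r prod_ge by (induction C) (auto intro!: mult_le_one)
  note unit = prod_ge prod_le
  have replicate: "measure_pmf.expectation (replicate_pmf k p) (\<lambda>xs. \<Prod>y\<in>#mset xs. r y) =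
      measure_pmf.expectation p r ^ k" for k p
    by (induction k) (simp_all add: expectation_bind_pmf unit r mult_le_one)
  have children: "measure_pmf.expectation (children P \<mu> x) (\<lambda>C. \<Prod>y\<in>#C. r y) =
      1 - mark_prob \<mu> (1 - measure_pmf.expectation (P x) r)" for x
  proof -
    have "measure_pmf.expectation (children P \<mu> x) (\<lambda>C. \<Prod>y\<in>#C. r y) =
        measure_pmf.expectation \<mu> (\<lambda>k. measure_pmf.expectation (P x) r ^ k)"
      unfolding children_def by (simp add: expectation_bind_pmf unit replicate)
    moreover have "integrable (measure_pmf \<mu>) (\<lambda>k. measure_pmf.expectation (P x) r ^ k)"
      using expectation_unit_interval[of r "P x"] r
      by (intro integrable_pmf_unit_interval) (auto intro: power_le_one)
    ultimately show ?thesis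
      by (simp add: mark_prob_def)
  qed
  show ?thesis
  proof (induction B)
    case empty
    then show ?case by (simp add: branching_step_empty)
  next
    case (add x B)
    have "measure_pmf.expectation (branching_step P \<mu> (add_mset x B)) (\<lambda>C. \<Prod>y\<in>#C. r y) =
      measure_pmf.expectation (children P \<mu> x) (\<lambda>C. \<Prod>y\<in>#C. r y) *
      measure_pmf.expectation (branching_step P \<mu> B) (\<lambda>C. \<Prod>y\<in>#C. r y)"
      by (simp add: branching_step_add_mset expectation_bind_pmf unit)
    then show ?case by (simp add: add.IH children)
  qed
qed

text \<open>
  The law of the first \<open>k + 1\<close> configurations.  The recursion is on the first step rather than
  the last one, and the start is an arbitrary configuration, so that induction on \<open>k\<close> can be
  combined with the branching property.
\<close>

primrec trajectory :: "('a \<Rightarrow> 'a pmf) \<Rightarrow> nat pmf \<Rightarrow> nat \<Rightarrow> 'a multiset \<Rightarrow> 'a multiset list pmf" where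
  "trajectory P \<mu> 0 B = return_pmf [B]"
| "trajectory P \<mu> (Suc k) B =
     do {C \<leftarrow> branching_step P \<mu> B; bs \<leftarrow> trajectory P \<mu> k C; return_pmf (B # bs)}"

lemma pmf_trajectory:
  assumes "length bs = Suc k"
  shows "pmf (trajectory P \<mu> k B) bs =
    indicator {B} (bs ! 0) * (\<Prod>i<k. pmf (branching_step P \<mu> (bs ! i)) (bs ! Suc i))"
  using assms
proof (induction k arbitrary: B bs)
  case 0
  then obtain b where "bs = [b]" by (auto simp: length_Suc_conv)
  then show ?case by (auto simp: indicator_def)
next
  case (Suc k)
  then obtain b cs where bs: "bs = b # cs" "length cs = Suc k" by (auto simp: length_Suc_conv)
  let ?p = "\<Prod>i<k. pmf (branching_step P \<mu> (cs ! i)) (cs ! Suc i)"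
  have "pmf (trajectory P \<mu> k C \<bind> (\<lambda>bs. return_pmf (B # bs))) (b # cs) =
      indicator {B} b * (indicator {C} (cs ! 0) * ?p)" for C
  proof (cases "b = B")
    case True
    then show ?thesis
      using pmf_map_inj'[of "(#) B" "trajectory P \<mu> k C" cs] Suc.IH[OF bs(2)]
      by (simp add: map_pmf_def)
  next
    case False
    then show ?thesis
      using pmf_eq_0_set_pmf[of "trajectory P \<mu> k C \<bind> (\<lambda>bs. return_pmf (B # bs))" "b # cs"]
      by auto
  qed
  then have "pmf (trajectory P \<mu> (Suc k) B) bs =
      measure_pmf.expectation (branching_step P \<mu> B)
        (\<lambda>C. indicator {cs ! 0} C * (indicator {B} b * ?p))"
    by (simp add: bs(1) pmf_bind[of "branching_step P \<mu> B"] indicator_def mult_ac if_distrib cong: if_cong)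
      (auto intro!: Bochner_Integration.integral_cong)
  also have "\<dots> = pmf (branching_step P \<mu> B) (cs ! 0) * (indicator {B} b * ?p)"
    by (simp add: measure_pmf_single)
  finally show ?case
    by (auto simp: bs(1) prod.lessThan_Suc_shift indicator_def simp del: prod.lessThan_Suc)
qed

lemma length_trajectory: "bs \<in> set_pmf (trajectory P \<mu> k B) \<Longrightarrow> length bs = Suc k"
  by (induction k arbitrary: B bs) auto

lemma countable_multisets: "countable (UNIV :: 'a::countable multiset set)"
proof -
  have "(UNIV :: 'a multiset set) = range mset" by (metis surj_mset)
  then show ?thesis by (metis countable_image countableI_type)
qed

lemma space_branching_law: "space (branching_law P \<mu> x) = UNIV"
  using sets_eq_imp_space_eq[OF sets_branching_law[of P \<mu> x]] by (simp add: space_PiM)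

text \<open>
  Finite sequences of configurations form a countable set, so it suffices to compare the two laws
  on single sequences, that is, on cylinders of the path space.
\<close>

lemma distr_branching_law_trajectory:
  fixes P :: "'a::countable \<Rightarrow> 'a pmf"
  shows "(\<lambda>\<omega>. map \<omega> [0..<Suc k]) \<in> measurable (branching_law P \<mu> x) (count_space UNIV)" (is ?meas)
    and "distr (branching_law P \<mu> x) (count_space UNIV) (\<lambda>\<omega>. map \<omega> [0..<Suc k]) =
      measure_pmf (trajectory P \<mu> k {#x#})" (is ?distr)
proof -
  let ?f = "\<lambda>\<omega> :: nat \<Rightarrow> 'a multiset. map \<omega> [0..<Suc k]"
  have ctbl: "countable (UNIV :: 'a multiset list set)"
    using countable_lists[OF countable_multisets[where 'a = 'a]] by simp
  have comp: "(\<lambda>\<omega>. \<omega> i) \<in> measurable (branching_law P \<mu> x) (count_space UNIV)" for i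
    unfolding measurable_cong_sets[OF sets_branching_law refl]
    by (rule measurable_component_singleton) simp
  have cylinder: "{\<omega>. \<forall>i\<le>k. \<omega> i = b i} \<in> sets (branching_law P \<mu> x)" for b
  proof -
    have "{\<omega> \<in> space (branching_law P \<mu> x). \<forall>i\<in>{..k}. \<omega> i = b i} \<in> sets (branching_law P \<mu> x)"
      using measurable_sets[OF comp, of "{b i}" for i]
      by (intro sets.sets_Collect_finite_All)
        (auto simp: vimage_def space_branching_law)
    then show ?thesis by (simp add: space_branching_law Ball_def)
  qed
  have vimage: "?f -` {bs} = (if length bs = Suc k then {\<omega>. \<forall>i\<le>k. \<omega> i = bs ! i} else {})" for bs
  proof (cases "length bs = Suc k")
    case True
    then show ?thesis
      by (simp add: vimage_def list_eq_iff_nth_eq less_Suc_eq_le del: upt_Suc)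
  next
    case False
    then have "?f \<omega> \<noteq> bs" for \<omega> by auto
    then show ?thesis using False by (simp add: vimage_def del: upt_Suc)
  qed
  show meas: ?meas
    unfolding measurable_count_space_eq_countable[OF ctbl] space_branching_law
    by (simp add: vimage cylinder del: upt_Suc)
  show ?distr
  proof (rule measure_eqI_countable[where A = UNIV])
    fix bs :: "'a multiset list"
    have "emeasure (distr (branching_law P \<mu> x) (count_space UNIV) ?f) {bs} =
        emeasure (branching_law P \<mu> x) (?f -` {bs})"
      using meas by (subst emeasure_distr) (auto simp: space_branching_law simp del: upt_Suc)
    also have "\<dots> = ennreal (pmf (trajectory P \<mu> k {#x#}) bs)"
    proof (cases "length bs = Suc k")
      case True
      then show ?thesis
        by (simp add: vimage emeasure_branching_law_cylinder pmf_trajectory ennreal_mult'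
              prod_ennreal indicator_def prod_nonneg del: upt_Suc)
    next
      case False
      then have "pmf (trajectory P \<mu> k {#x#}) bs = 0"
        using length_trajectory pmf_eq_0_set_pmf by metis
      then show ?thesis using False by (simp add: vimage del: upt_Suc)
    qed
    finally show "emeasure (distr (branching_law P \<mu> x) (count_space UNIV) ?f) {bs} =
        emeasure (measure_pmf (trajectory P \<mu> k {#x#})) {bs}"
      by (simp add: emeasure_pmf_single del: upt_Suc)
  qed (simp_all add: ctbl del: upt_Suc)
qed

lemma trajectory_nth_0: "bs \<in> set_pmf (trajectory P \<mu> k B) \<Longrightarrow> bs ! 0 = B"
  by (cases k) auto

lemma trajectory_extinct:
  assumes "bs \<in> set_pmf (trajectory P \<mu> k B)" "i < k" "bs ! i = {#}"
  shows "bs ! Suc i = {#}"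
  using assms
proof (induction k arbitrary: B bs i)
  case (Suc k)
  then obtain C cs where C: "C \<in> set_pmf (branching_step P \<mu> B)"
    and cs: "cs \<in> set_pmf (trajectory P \<mu> k C)" "bs = B # cs"
    by auto
  show ?case
  proof (cases i)
    case 0
    then have "C = {#}" using C Suc.prems(3) cs(2) by (simp add: branching_step_empty)
    then show ?thesis using 0 trajectory_nth_0[OF cs(1)] cs(2) by simp
  next
    case (Suc j)
    then show ?thesis using Suc.IH[OF cs(1), of j] Suc.prems cs(2) by simp
  qed
qed simp

lemma AE_extinct:
  fixes P :: "'a::countable \<Rightarrow> 'a pmf"
  shows "AE \<omega> in branching_law P \<mu> x. \<forall>i. \<omega> i = {#} \<longrightarrow> \<omega> (Suc i) = {#}"
  unfolding AE_all_countable
proof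
  fix i
  let ?Q = "\<lambda>bs :: 'a multiset list. bs ! i = {#} \<longrightarrow> bs ! Suc i = {#}"
  have "AE bs in measure_pmf (trajectory P \<mu> (Suc i) {#x#}). ?Q bs"
    using trajectory_extinct[of _ P \<mu> "Suc i" "{#x#}" i] by (auto simp: AE_measure_pmf_iff)
  then have "AE \<omega> in branching_law P \<mu> x. ?Q (map \<omega> [0..<Suc (Suc i)])"
    unfolding distr_branching_law_trajectory(2)[symmetric]
    by (rule AE_distrD[OF distr_branching_law_trajectory(1)])
  then show "AE \<omega> in branching_law P \<mu> x. \<omega> i = {#} \<longrightarrow> \<omega> (Suc i) = {#}"
    by (simp add: nth_append)
qed

section \<open>Hitting a moving target\<close>

text \<open>
  The probability, from one particle at \<open>x\<close>, that some particle is in \<open>D i\<close> at some time \<open>i \<le> k\<close>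
  (see \<open>prob_branching_law_hit\<close>).  The target moves with time so that visits to a set after a
  given time are an instance.
\<close>

primrec hit_prob :: "('a \<Rightarrow> 'a pmf) \<Rightarrow> nat pmf \<Rightarrow> nat \<Rightarrow> (nat \<Rightarrow> 'a set) \<Rightarrow> 'a \<Rightarrow> real" where
  "hit_prob P \<mu> 0 D x = indicator (D 0) x"
| "hit_prob P \<mu> (Suc k) D x =
     (if x \<in> D 0 then 1
      else mark_prob \<mu> (measure_pmf.expectation (P x) (hit_prob P \<mu> k (\<lambda>i. D (Suc i)))))"

lemma hit_prob_unit_interval: "0 \<le> hit_prob P \<mu> k D x" "hit_prob P \<mu> k D x \<le> 1"
proof -
  have "0 \<le> hit_prob P \<mu> k D x \<and> hit_prob P \<mu> k D x \<le> 1"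
    by (induction k arbitrary: D x)
      (auto simp: indicator_def intro!: mark_prob_unit_interval expectation_unit_interval)
  then show "0 \<le> hit_prob P \<mu> k D x" "hit_prob P \<mu> k D x \<le> 1" by auto
qed

text \<open>
  The target is avoided from \<open>B\<close> if and only if it is avoided by the descendants of each
  particle of \<open>B\<close>, and these families are independent.
\<close>

lemma prob_trajectory_avoids:
  "measure_pmf.expectation (trajectory P \<mu> k B)
     (\<lambda>bs. of_bool (\<forall>i\<le>k. set_mset (bs ! i) \<inter> D i = {})) =
   (\<Prod>x\<in>#B. 1 - hit_prob P \<mu> k D x)"
proof (induction k arbitrary: B D)
  case 0
  show ?case by (induction B) (auto simp: indicator_def)
next
  case (Suc k)
  let ?D = "\<lambda>i. D (Suc i)"
  let ?h = "hit_prob P \<mu> k ?D"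
  have h: "0 \<le> ?h x" "?h x \<le> 1" for x
    by (rule hit_prob_unit_interval)+
  have shift: "(\<forall>i\<le>Suc k. set_mset ((B # bs) ! i) \<inter> D i = {}) \<longleftrightarrow>
      set_mset B \<inter> D 0 = {} \<and> (\<forall>i\<le>k. set_mset (bs ! i) \<inter> ?D i = {})" for bs
    using All_less_Suc2[of "Suc k" "\<lambda>i. set_mset ((B # bs) ! i) \<inter> D i = {}"]
    by (simp add: less_Suc_eq_le)
  have step: "measure_pmf.expectation (trajectory P \<mu> (Suc k) B) G =
      measure_pmf.expectation (branching_step P \<mu> B)
        (\<lambda>C. measure_pmf.expectation (trajectory P \<mu> k C) (\<lambda>bs. G (B # bs)))"
    if "\<And>bs. 0 \<le> G bs" "\<And>bs. G bs \<le> 1" for G :: "'a multiset list \<Rightarrow> real"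
    using that by (simp add: expectation_bind_pmf)
  have "measure_pmf.expectation (trajectory P \<mu> (Suc k) B)
      (\<lambda>bs. of_bool (\<forall>i\<le>Suc k. set_mset (bs ! i) \<inter> D i = {}) :: real) =
    measure_pmf.expectation (branching_step P \<mu> B) (\<lambda>C. of_bool (set_mset B \<inter> D 0 = {}) *
      measure_pmf.expectation (trajectory P \<mu> k C)
       (\<lambda>bs. of_bool (\<forall>i\<le>k. set_mset (bs ! i) \<inter> ?D i = {})))"
    by (subst step) (simp_all add: shift of_bool_conj del: trajectory.simps)
  also have "\<dots> = of_bool (set_mset B \<inter> D 0 = {}) *
      measure_pmf.expectation (branching_step P \<mu> B) (\<lambda>C. \<Prod>y\<in>#C. 1 - ?h y)"
    unfolding Suc.IH by simp
  also have "\<dots> = of_bool (set_mset B \<inter> D 0 = {}) *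
      (\<Prod>x\<in>#B. 1 - mark_prob \<mu> (measure_pmf.expectation (P x) ?h))"
    using h by (subst expectation_prod_mset_branching_step)
      (auto simp: integrable_pmf_unit_interval Bochner_Integration.integral_diff)
  also have "\<dots> = (\<Prod>x\<in>#B. 1 - hit_prob P \<mu> (Suc k) D x)"
    by (induction B) auto
  finally show ?case .
qed

lemma prob_branching_law_hit:
  fixes P :: "'a::countable \<Rightarrow> 'a pmf" and k :: nat and D :: "nat \<Rightarrow> 'a set"
  defines "E \<equiv> {\<omega>. \<exists>i\<le>k. set_mset (\<omega> i) \<inter> D i \<noteq> {}}"
  shows "E \<in> sets (branching_law P \<mu> x)" (is ?sets)
    and "measure (branching_law P \<mu> x) E = hit_prob P \<mu> k D x" (is ?prob)
proof -
  interpret prob_space "branching_law P \<mu> x" by (rule prob_space_branching_law)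
  let ?f = "\<lambda>\<omega> :: nat \<Rightarrow> 'a multiset. map \<omega> [0..<Suc k]"
  define V where "V = {bs. \<forall>i\<le>k. set_mset (bs ! i) \<inter> D i = {}}"
  note f = distr_branching_law_trajectory[where P = P and k = k and \<mu> = \<mu> and x = x]
  have "?f \<omega> \<in> V \<longleftrightarrow> \<omega> \<notin> E" for \<omega>
    by (auto simp: V_def E_def less_Suc_eq_le simp del: upt_Suc)
  then have E: "?f -` (- V) \<inter> space (branching_law P \<mu> x) = E"
    by (auto simp: space_branching_law simp del: upt_Suc)
  show ?sets
    using measurable_sets[OF f(1), of "- V"] unfolding E by simp
  have "measure (branching_law P \<mu> x) E =
      measure (distr (branching_law P \<mu> x) (count_space UNIV) ?f) (- V)"
    unfolding E[symmetric] by (rule measure_distr[OF f(1), symmetric]) simp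
  also have "\<dots> = measure_pmf.prob (trajectory P \<mu> k {#x#}) (- V)"
    by (simp only: f(2))
  also have "\<dots> = 1 - measure_pmf.prob (trajectory P \<mu> k {#x#}) V"
    using measure_pmf.prob_compl[of V] by (simp add: Compl_eq_Diff_UNIV)
  also have "measure_pmf.prob (trajectory P \<mu> k {#x#}) V =
      measure_pmf.expectation (trajectory P \<mu> k {#x#}) (indicator V)"
    by simp
  also have "indicator V = (\<lambda>bs. of_bool (\<forall>i\<le>k. set_mset (bs ! i) \<inter> D i = {}) :: real)"
    by (auto simp: V_def indicator_def of_bool_def)
  also have "measure_pmf.expectation (trajectory P \<mu> k {#x#}) \<dots> = 1 - hit_prob P \<mu> k D x"
    using prob_trajectory_avoids[of P \<mu> k "{#x#}" D] by simp
  finally show ?prob by simp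
qed

text \<open>
  The factor \<open>\<epsilon>\<close> moves every probability to which \<open>mark_prob\<close> is applied into the interval where
  the two functions can be compared; \<open>mark_prob_scale\<close> moves it inwards at each step.
\<close>

lemma hit_prob_comparison:
  assumes germ: "\<And>t. 0 \<le> t \<Longrightarrow> t \<le> \<epsilon> \<Longrightarrow> mark_prob \<mu> t \<le> mark_prob \<nu> t"
    and \<epsilon>: "0 \<le> \<epsilon>" "\<epsilon> \<le> 1"
  shows "\<epsilon> * hit_prob P \<mu> k D x \<le> hit_prob P \<nu> k D x"
proof (induction k arbitrary: D x)
  case 0
  show ?case using \<epsilon> by (simp add: indicator_def)
next
  case (Suc k)
  let ?D = "\<lambda>i. D (Suc i)"
  let ?p = "\<lambda>\<mu>. measure_pmf.expectation (P x) (hit_prob P \<mu> k ?D)"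
  have p: "0 \<le> ?p \<mu>" "?p \<mu> \<le> 1" for \<mu>
    by (intro expectation_unit_interval hit_prob_unit_interval)+
  have int: "integrable (measure_pmf (P x)) (hit_prob P \<mu> k ?D)" for \<mu>
    by (intro integrable_pmf_unit_interval hit_prob_unit_interval)
  have "\<epsilon> * mark_prob \<mu> (?p \<mu>) \<le> mark_prob \<mu> (\<epsilon> * ?p \<mu>)"
    using \<epsilon> p by (intro mark_prob_scale)
  also have "\<dots> \<le> mark_prob \<nu> (\<epsilon> * ?p \<mu>)"
    using \<epsilon> p by (intro germ) (auto simp: mult_left_le)
  also have "\<epsilon> * ?p \<mu> = measure_pmf.expectation (P x) (\<lambda>y. \<epsilon> * hit_prob P \<mu> k ?D y)"
    by simp
  also have "mark_prob \<nu> \<dots> \<le> mark_prob \<nu> (?p \<nu>)"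
  proof (rule mark_prob_mono)
    show "0 \<le> measure_pmf.expectation (P x) (\<lambda>y. \<epsilon> * hit_prob P \<mu> k ?D y)"
      using \<epsilon> by (intro Bochner_Integration.integral_nonneg) (simp add: hit_prob_unit_interval)
    show "measure_pmf.expectation (P x) (\<lambda>y. \<epsilon> * hit_prob P \<mu> k ?D y) \<le> ?p \<nu>"
      by (intro integral_mono integrable_mult_right int Suc.IH)
  qed (rule p)
  finally show ?case using \<epsilon> by simp
qed

section \<open>Late visits and infinitely many visits\<close>

definition late_visit_prob :: "('a::countable \<Rightarrow> 'a pmf) \<Rightarrow> nat pmf \<Rightarrow> 'a set \<Rightarrow> nat \<Rightarrow> 'a \<Rightarrow> real" where
  "late_visit_prob P \<mu> A n x =
     measure (branching_law P \<mu> x) {\<omega>. \<exists>i\<ge>n. set_mset (\<omega> i) \<inter> A \<noteq> {}}"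

text \<open>
  A late visit is the increasing limit, over the horizon \<open>k\<close>, of hitting a target that is empty
  before time \<open>n\<close>.
\<close>

lemma late_visit_eq_UN:
  "{\<omega> :: nat \<Rightarrow> 'a multiset. \<exists>i\<ge>n. set_mset (\<omega> i) \<inter> A \<noteq> {}} =
    (\<Union>k. {\<omega>. \<exists>i\<le>k. set_mset (\<omega> i) \<inter> (if n \<le> i then A else {}) \<noteq> {}})"
proof (intro set_eqI iffI)
  fix \<omega> assume "\<omega> \<in> {\<omega>. \<exists>i\<ge>n. set_mset (\<omega> i) \<inter> A \<noteq> {}}"
  then obtain i where "n \<le> i" "set_mset (\<omega> i) \<inter> A \<noteq> {}" by blast
  then have "\<exists>j\<le>i. set_mset (\<omega> j) \<inter> (if n \<le> j then A else {}) \<noteq> {}"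
    by (intro exI[of _ i]) simp
  then show "\<omega> \<in> (\<Union>k. {\<omega>. \<exists>i\<le>k. set_mset (\<omega> i) \<inter> (if n \<le> i then A else {}) \<noteq> {}})"
    by blast
qed (auto split: if_splits)

lemma sets_late_visit:
  "{\<omega>. \<exists>i\<ge>n. set_mset (\<omega> i) \<inter> A \<noteq> {}} \<in> sets (branching_law P \<mu> x)"
  unfolding late_visit_eq_UN by (intro sets.countable_UN image_subsetI prob_branching_law_hit(1))

lemma late_visit_prob_unit_interval:
  "0 \<le> late_visit_prob P \<mu> A n x" "late_visit_prob P \<mu> A n x \<le> 1"
  unfolding late_visit_prob_def
  by (auto intro: prob_space.prob_le_1[OF prob_space_branching_law])

lemma hit_prob_tendsto_late_visit_prob:
  fixes P :: "'a::countable \<Rightarrow> 'a pmf"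
  shows "(\<lambda>k. hit_prob P \<mu> k (\<lambda>i. if n \<le> i then A else {}) x) \<longlonglongrightarrow> late_visit_prob P \<mu> A n x"
proof -
  interpret prob_space "branching_law P \<mu> x" by (rule prob_space_branching_law)
  show ?thesis
    unfolding late_visit_prob_def late_visit_eq_UN prob_branching_law_hit(2)[symmetric]
  proof (rule finite_Lim_measure_incseq)
    show "incseq (\<lambda>k. {\<omega> :: nat \<Rightarrow> 'a multiset.
        \<exists>i\<le>k. set_mset (\<omega> i) \<inter> (if n \<le> i then A else {}) \<noteq> {}})"
      unfolding incseq_def by (blast intro: order_trans)
  qed (intro image_subsetI prob_branching_law_hit(1))
qed

lemma late_visit_prob_0:
  assumes "x \<in> A"
  shows "late_visit_prob P \<mu> A 0 x = 1"
proof -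
  have "hit_prob P \<mu> k (\<lambda>i. if 0 \<le> i then A else {}) x = 1" for k
    using assms by (cases k) auto
  then show ?thesis
    using hit_prob_tendsto_late_visit_prob[of P \<mu> 0 A x] by (simp add: LIMSEQ_const_iff)
qed

text \<open>
  The Markov and branching properties at time 1, passed to the limit of an infinite horizon.  A
  visit at time 0 does not count on the left, so no case distinction on \<open>x \<in> A\<close> appears.
\<close>

lemma late_visit_prob_Suc:
  "late_visit_prob P \<mu> A (Suc n) x =
    mark_prob \<mu> (measure_pmf.expectation (P x) (late_visit_prob P \<mu> A n))"
proof (rule LIMSEQ_unique)
  let ?D = "\<lambda>n i. if n \<le> i then A else {}"
  show "(\<lambda>k. hit_prob P \<mu> (Suc k) (?D (Suc n)) x) \<longlonglongrightarrow> late_visit_prob P \<mu> A (Suc n) x"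
    by (rule LIMSEQ_Suc[OF hit_prob_tendsto_late_visit_prob])
  have "(\<lambda>k. mark_prob \<mu> (measure_pmf.expectation (P x) (hit_prob P \<mu> k (?D n)))) \<longlonglongrightarrow>
      mark_prob \<mu> (measure_pmf.expectation (P x) (late_visit_prob P \<mu> A n))"
  proof (rule mark_prob_tendsto)
    show "(\<lambda>k. measure_pmf.expectation (P x) (hit_prob P \<mu> k (?D n))) \<longlonglongrightarrow>
        measure_pmf.expectation (P x) (late_visit_prob P \<mu> A n)"
      by (rule integral_dominated_convergence[where w = "\<lambda>_. 1"])
        (auto simp: hit_prob_tendsto_late_visit_prob hit_prob_unit_interval)
  qed (auto simp: hit_prob_unit_interval intro!: expectation_unit_interval)
  then show "(\<lambda>k. hit_prob P \<mu> (Suc k) (?D (Suc n)) x) \<longlonglongrightarrow>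
      mark_prob \<mu> (measure_pmf.expectation (P x) (late_visit_prob P \<mu> A n))"
    by simp
qed

lemma suminf_of_nat_eq_top_iff:
  fixes c :: "nat \<Rightarrow> nat"
  shows "(\<Sum>n. of_nat (c n) :: ennreal) = \<infinity> \<longleftrightarrow> (\<forall>n. \<exists>i\<ge>n. c i \<noteq> 0)"
proof
  assume inf: "(\<Sum>n. of_nat (c n) :: ennreal) = \<infinity>"
  show "\<forall>n. \<exists>i\<ge>n. c i \<noteq> 0"
  proof (rule ccontr)
    assume "\<not> ?thesis"
    then obtain n where "\<And>i. n \<le> i \<Longrightarrow> c i = 0" by auto
    then have "(\<Sum>n. of_nat (c n) :: ennreal) = (\<Sum>i<n. of_nat (c i))"
      by (intro suminf_finite) (auto simp: not_less)
    also have "\<dots> = of_nat (\<Sum>i<n. c i)" by simp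
    finally show False using inf of_nat_less_top[of "\<Sum>i<n. c i"] by simp
  qed
next
  assume "\<forall>n. \<exists>i\<ge>n. c i \<noteq> 0"
  then have "infinite {i. c i \<noteq> 0}"
    by (simp add: infinite_nat_iff_unbounded_le)
  then have "(\<infinity>::ennreal) = (\<integral>\<^sup>+i. indicator {i. c i \<noteq> 0} i \<partial>count_space UNIV)"
    by simp
  also have "\<dots> \<le> (\<integral>\<^sup>+i. of_nat (c i) \<partial>count_space UNIV)"
    by (intro nn_integral_mono)
      (auto simp: indicator_def ennreal_of_nat_eq_real_of_nat simp flip: ennreal_1 intro!: ennreal_leI)
  finally show "(\<Sum>n. of_nat (c n) :: ennreal) = \<infinity>"
    by (simp add: nn_integral_count_space_nat top.extremum_unique)
qed

text \<open>
  Each configuration is finite, so infinitely many visits, even to an infinite set, require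
  visits at infinitely many times.
\<close>

lemma total_visits_eq_top_iff:
  "total_visits A \<omega> = \<infinity> \<longleftrightarrow> (\<forall>n. \<exists>i\<ge>n. set_mset (\<omega> i) \<inter> A \<noteq> {})"
proof -
  define c where "c n = (\<Sum>a\<in>set_mset (\<omega> n) \<inter> A. count (\<omega> n) a)" for n
  have "(\<integral>\<^sup>+a. of_nat (count (\<omega> n) a) \<partial>count_space A) = (of_nat (c n) :: ennreal)" for n
    unfolding c_def of_nat_sum
    by (rule nn_integral_count_space') (auto simp: not_in_iff)
  then have "total_visits A \<omega> = (\<Sum>n. of_nat (c n))"
    unfolding total_visits_def by (simp add: nn_integral_suminf)
  moreover have "c n \<noteq> 0 \<longleftrightarrow> set_mset (\<omega> n) \<inter> A \<noteq> {}" for n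
    by (auto simp: c_def)
  ultimately show ?thesis
    by (simp only: suminf_of_nat_eq_top_iff)
qed

definition infinite_visit_prob :: "('a::countable \<Rightarrow> 'a pmf) \<Rightarrow> nat pmf \<Rightarrow> 'a set \<Rightarrow> 'a \<Rightarrow> real" where
  "infinite_visit_prob P \<mu> A x = \<P>(\<omega> in branching_law P \<mu> x. total_visits A \<omega> = \<infinity>)"

lemma late_visit_prob_tendsto:
  fixes P :: "'a::countable \<Rightarrow> 'a pmf"
  shows "(\<lambda>n. late_visit_prob P \<mu> A n x) \<longlonglongrightarrow> infinite_visit_prob P \<mu> A x"
proof -
  interpret prob_space "branching_law P \<mu> x" by (rule prob_space_branching_law)
  have "(\<lambda>n. measure (branching_law P \<mu> x) {\<omega>. \<exists>i\<ge>n. set_mset (\<omega> i) \<inter> A \<noteq> {}}) \<longlonglongrightarrow>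
      measure (branching_law P \<mu> x) (\<Inter>n. {\<omega>. \<exists>i\<ge>n. set_mset (\<omega> i) \<inter> A \<noteq> {}})"
  proof (rule finite_Lim_measure_decseq)
    show "decseq (\<lambda>n. {\<omega> :: nat \<Rightarrow> 'a multiset. \<exists>i\<ge>n. set_mset (\<omega> i) \<inter> A \<noteq> {}})"
      unfolding decseq_def by (blast intro: order_trans)
  qed (intro image_subsetI sets_late_visit)
  moreover have "{\<omega> \<in> space (branching_law P \<mu> x). total_visits A \<omega> = \<infinity>} =
      (\<Inter>n. {\<omega>. \<exists>i\<ge>n. set_mset (\<omega> i) \<inter> A \<noteq> {}})"
    by (simp only: total_visits_eq_top_iff space_branching_law) auto
  ultimately show ?thesis by (simp add: late_visit_prob_def infinite_visit_prob_def)
qed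

lemma late_visit_prob_Suc_le: "late_visit_prob P \<mu> A (Suc n) x \<le> late_visit_prob P \<mu> A n x"
proof -
  interpret prob_space "branching_law P \<mu> x" by (rule prob_space_branching_law)
  show ?thesis
    unfolding late_visit_prob_def
    by (intro finite_measure_mono sets_late_visit) (auto dest: Suc_leD)
qed

lemma infinite_visit_prob_unit_interval:
  "0 \<le> infinite_visit_prob P \<mu> A x" "infinite_visit_prob P \<mu> A x \<le> 1"
  unfolding infinite_visit_prob_def
  by (auto intro: prob_space.prob_le_1[OF prob_space_branching_law])

lemma infinite_visit_prob_le_UNIV:
  "infinite_visit_prob P \<mu> A x \<le> infinite_visit_prob P \<mu> UNIV x"
proof (rule LIMSEQ_le[OF late_visit_prob_tendsto late_visit_prob_tendsto])
  interpret prob_space "branching_law P \<mu> x" by (rule prob_space_branching_law)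
  have "late_visit_prob P \<mu> A n x \<le> late_visit_prob P \<mu> UNIV n x" for n
    unfolding late_visit_prob_def by (intro finite_measure_mono sets_late_visit) auto
  then show "\<exists>N. \<forall>n\<ge>N. late_visit_prob P \<mu> A n x \<le> late_visit_prob P \<mu> UNIV n x" by blast
qed

lemma infinite_visit_prob_comparison:
  assumes germ: "\<And>t. 0 \<le> t \<Longrightarrow> t \<le> \<epsilon> \<Longrightarrow> mark_prob \<mu> t \<le> mark_prob \<nu> t"
    and \<epsilon>: "0 \<le> \<epsilon>" "\<epsilon> \<le> 1"
  shows "\<epsilon> * infinite_visit_prob P \<mu> A x \<le> infinite_visit_prob P \<nu> A x"
proof -
  have "\<epsilon> * late_visit_prob P \<mu> A n x \<le> late_visit_prob P \<nu> A n x" for n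
    by (rule LIMSEQ_le[OF tendsto_mult_left[OF hit_prob_tendsto_late_visit_prob]
          hit_prob_tendsto_late_visit_prob])
      (intro exI allI impI hit_prob_comparison germ \<epsilon>)
  then show ?thesis
    by (intro LIMSEQ_le[OF tendsto_mult_left[OF late_visit_prob_tendsto]
          late_visit_prob_tendsto]) blast
qed

section \<open>Survival as infinitely many visits to the whole space\<close>

lemma late_visit_prob_UNIV: "late_visit_prob P \<mu> UNIV n x = (mark_prob \<mu> ^^ n) 1"
proof (induction n arbitrary: x)
  case (Suc n)
  then have "late_visit_prob P \<mu> UNIV n = (\<lambda>_. (mark_prob \<mu> ^^ n) 1)" by blast
  then show ?case by (simp add: late_visit_prob_Suc)
qed (simp add: late_visit_prob_0)

lemma infinite_visit_prob_UNIV_eq: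
  "infinite_visit_prob P \<mu> UNIV x = infinite_visit_prob P \<mu> UNIV y"
  using late_visit_prob_tendsto[of P \<mu> UNIV x]
    late_visit_prob_tendsto[of P \<mu> UNIV y]
  unfolding late_visit_prob_UNIV by (rule LIMSEQ_unique)

lemma mark_prob_infinite_visit_prob_UNIV:
  "mark_prob \<mu> (infinite_visit_prob P \<mu> UNIV x) = infinite_visit_prob P \<mu> UNIV x"
proof (rule LIMSEQ_unique)
  show "(\<lambda>n. late_visit_prob P \<mu> UNIV (Suc n) x) \<longlonglongrightarrow> infinite_visit_prob P \<mu> UNIV x"
    by (rule LIMSEQ_Suc[OF late_visit_prob_tendsto])
  have "(\<lambda>n. mark_prob \<mu> (late_visit_prob P \<mu> UNIV n x)) \<longlonglongrightarrow>
      mark_prob \<mu> (infinite_visit_prob P \<mu> UNIV x)"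
    by (intro mark_prob_tendsto late_visit_prob_tendsto late_visit_prob_unit_interval)
  then show "(\<lambda>n. late_visit_prob P \<mu> UNIV (Suc n) x) \<longlonglongrightarrow>
      mark_prob \<mu> (infinite_visit_prob P \<mu> UNIV x)"
    by (simp add: late_visit_prob_UNIV)
qed

text \<open>
  The survival probability \<open>s\<close> is a fixed point of \<open>mark_prob \<mu>\<close>, which is at most \<open>m * s\<close> with
  \<open>m < 1\<close>.
\<close>

lemma infinite_visit_prob_subcritical:
  assumes "offspring_mean \<mu> < 1"
  shows "infinite_visit_prob P \<mu> A x = 0"
proof -
  let ?s = "infinite_visit_prob P \<mu> UNIV x"
  obtain m where m: "offspring_mean \<mu> = ennreal m" "0 \<le> m" "m < 1"
    using assms by (cases "offspring_mean \<mu>") (auto simp flip: ennreal_1 simp: ennreal_less_iff)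
  have "?s \<le> m * ?s"
    using mark_prob_le_mean[of \<mu> m ?s] m infinite_visit_prob_unit_interval[of P \<mu> UNIV x]
    by (simp add: mark_prob_infinite_visit_prob_UNIV)
  then have "(1 - m) * ?s \<le> 0" by (simp add: algebra_simps)
  then have "?s \<le> 0" using m(3) by (simp add: mult_le_0_iff)
  then show ?thesis
    using infinite_visit_prob_le_UNIV[of P \<mu> A x] infinite_visit_prob_unit_interval(1)[of P \<mu> A x]
    by linarith
qed

text \<open>
  Almost surely an empty configuration is never left, so being nonempty infinitely often is the
  same as being nonempty always.  Survival is thus the case \<open>A = UNIV\<close> of infinitely many visits.
\<close>

lemma AE_survives_iff:
  "AE \<omega> in branching_law P \<mu> x. survives \<omega> \<longleftrightarrow> total_visits UNIV \<omega> = \<infinity>"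
  using AE_extinct
proof eventually_elim
  case (elim \<omega>)
  have "\<omega> j = {#}" if "\<omega> i = {#}" "i \<le> j" for i j
    using that(2) by (induction j rule: dec_induct) (use that(1) elim in auto)
  then show ?case
    unfolding survives_def total_visits_eq_top_iff
    by (simp add: nonempty_has_size[symmetric]) (metis order_refl)
qed

lemma transient_set_iff: "transient_set P \<mu> A \<longleftrightarrow> (\<forall>x. infinite_visit_prob P \<mu> A x = 0)"
  by (simp add: transient_set_def infinite_visit_prob_def)

text \<open>
  Up to a null set, infinitely many visits imply survival, so the conditional probability is a
  quotient of two infinite visit probabilities.
\<close>

lemma recurrent_set_iff:
  "recurrent_set P \<mu> A \<longleftrightarrow>
    (\<forall>x. 0 < infinite_visit_prob P \<mu> UNIV x \<and>
         infinite_visit_prob P \<mu> A x = infinite_visit_prob P \<mu> UNIV x)"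
proof -
  have "\<P>(\<omega> in branching_law P \<mu> x. survives \<omega>) = infinite_visit_prob P \<mu> UNIV x" (is ?surv)
    and "\<P>(\<omega> in branching_law P \<mu> x. total_visits A \<omega> = \<infinity> \<and> survives \<omega>) =
      infinite_visit_prob P \<mu> A x" (is ?inf)
    for x
  proof -
    interpret prob_space "branching_law P \<mu> x" by (rule prob_space_branching_law)
    note [measurable] = measurable_total_visits pred_survives
    show ?surv
      unfolding infinite_visit_prob_def using AE_survives_iff by (rule prob_eq_AE) measurable
    have "AE \<omega> in branching_law P \<mu> x. total_visits A \<omega> = \<infinity> \<and> survives \<omega> \<longleftrightarrow> total_visits A \<omega> = \<infinity>"
      using AE_survives_iff
    proof eventually_elim
      case (elim \<omega>)
      then show ?case unfolding total_visits_eq_top_iff by blast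
    qed
    then show ?inf
      unfolding infinite_visit_prob_def by (rule prob_eq_AE) measurable
  qed
  moreover have "0 < s \<and> a / s = 1 \<longleftrightarrow> 0 < s \<and> a = s" for a s :: real by auto
  ultimately show ?thesis
    by (simp add: recurrent_set_def cond_prob_def)
qed

section \<open>Monotonicity in the offspring distribution\<close>

lemma transient_set_antimono:
  assumes "0 < \<epsilon>" "\<epsilon> \<le> 1" "\<And>t. 0 \<le> t \<Longrightarrow> t \<le> \<epsilon> \<Longrightarrow> mark_prob \<mu> t \<le> mark_prob \<nu> t"
    and "transient_set P \<nu> A"
  shows "transient_set P \<mu> A"
  unfolding transient_set_iff
proof
  fix x
  have "\<epsilon> * infinite_visit_prob P \<mu> A x \<le> 0"
    using infinite_visit_prob_comparison[of \<epsilon> \<mu> \<nu> P A x] assms by (simp add: transient_set_iff)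
  then show "infinite_visit_prob P \<mu> A x = 0"
    using assms(1) infinite_visit_prob_unit_interval(1)[of P \<mu> A x] by (simp add: mult_le_0_iff)
qed

text \<open>
  A uniform lower bound improves itself to the survival probability: the infimum \<open>q\<close> of the late
  visit probabilities is a positive supersolution \<open>mark_prob \<nu> q \<le> q\<close>, hence at least the fixed
  point that is the survival probability.
\<close>

lemma recurrent_set_if_infinite_visit_prob_ge:
  assumes c: "0 < c" "\<And>x. c \<le> infinite_visit_prob P \<nu> A x"
    and near_0: "0 < \<epsilon>" "1 < m" "\<And>t. 0 \<le> t \<Longrightarrow> t \<le> \<epsilon> \<Longrightarrow> m * t \<le> mark_prob \<nu> t"
  shows "recurrent_set P \<nu> A"
proof -
  let ?u = "late_visit_prob P \<nu> A"
  have lim_le: "infinite_visit_prob P \<nu> A x \<le> ?u n x" for n x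
    by (rule decseq_ge[OF decseq_SucI late_visit_prob_tendsto])
      (rule late_visit_prob_Suc_le)
  define q where "q = (INF (n, x). ?u n x)"
  have bdd: "bdd_below (range (\<lambda>(n, x). ?u n x))"
    by (rule bdd_belowI2[of _ 0]) (auto simp: late_visit_prob_unit_interval)
  have q_le: "q \<le> ?u n x" for n x
    unfolding q_def using cINF_lower[OF bdd, of "(n, x)"] by simp
  have le_q: "b \<le> q" if "\<And>n x. b \<le> ?u n x" for b
    unfolding q_def by (rule cINF_greatest) (use that in auto)
  have q: "0 < q"
    using le_q[of c] order_trans[OF c(2) lim_le] c(1) by (meson order_less_le_trans)
  have "mark_prob \<nu> q \<le> ?u n x" for n x
  proof -
    have int: "integrable (measure_pmf (P x)) (?u n)"
      by (intro integrable_pmf_unit_interval late_visit_prob_unit_interval)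
    have "mark_prob \<nu> q \<le> mark_prob \<nu> (measure_pmf.expectation (P x) (?u n))"
      using q q_le int
      by (intro mark_prob_mono measure_pmf.integral_ge_const expectation_unit_interval
            late_visit_prob_unit_interval) auto
    also have "\<dots> = ?u (Suc n) x" by (simp add: late_visit_prob_Suc)
    finally show ?thesis using late_visit_prob_Suc_le[of P \<nu> A n x] by linarith
  qed
  then have mark_q: "mark_prob \<nu> q \<le> q" by (rule le_q)
  show ?thesis
    unfolding recurrent_set_iff
  proof (intro allI conjI antisym infinite_visit_prob_le_UNIV)
    fix x
    show "0 < infinite_visit_prob P \<nu> UNIV x"
      using c(1) c(2)[of x] infinite_visit_prob_le_UNIV[of P \<nu> A x] by linarith
    have "infinite_visit_prob P \<nu> UNIV x \<le> q"
      by (rule mark_prob_supersolution_ge_subsolution[OF near_0 q mark_q])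
        (simp_all add: infinite_visit_prob_unit_interval mark_prob_infinite_visit_prob_UNIV)
    then show "infinite_visit_prob P \<nu> UNIV x \<le> infinite_visit_prob P \<nu> A x"
      using q_le by (intro LIMSEQ_le_const[OF late_visit_prob_tendsto]) (meson order_trans)
  qed
qed

text \<open>
  For the recurrent \<open>\<mu>\<close> the infinite visit probability is the survival probability, which does not
  depend on the starting point; the comparison turns it into a uniform lower bound for \<open>\<nu>\<close>.
\<close>

lemma recurrent_set_mono:
  assumes \<epsilon>: "0 < \<epsilon>" "\<epsilon> \<le> 1"
    and germ: "\<And>t. 0 \<le> t \<Longrightarrow> t \<le> \<epsilon> \<Longrightarrow> mark_prob \<mu> t \<le> mark_prob \<nu> t"
    and m: "1 < m" "\<And>t. 0 \<le> t \<Longrightarrow> t \<le> \<epsilon> \<Longrightarrow> m * t \<le> mark_prob \<nu> t"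
    and rec: "recurrent_set P \<mu> A"
  shows "recurrent_set P \<nu> A"
proof (rule recurrent_set_if_infinite_visit_prob_ge[OF _ _ \<epsilon>(1) m])
  let ?s = "infinite_visit_prob P \<mu> UNIV undefined"
  show "0 < \<epsilon> * ?s" using rec \<epsilon> by (simp add: recurrent_set_iff)
  fix x
  have "infinite_visit_prob P \<mu> A x = ?s"
    using rec infinite_visit_prob_UNIV_eq[of P \<mu> x undefined] by (simp add: recurrent_set_iff)
  then show "\<epsilon> * ?s \<le> infinite_visit_prob P \<nu> A x"
    using infinite_visit_prob_comparison[of \<epsilon> \<mu> \<nu> P A x] \<epsilon> germ by simp
qed

text \<open>
  A line whose slope \<open>m\<close> lies strictly between the two means, and above 1, separates the two
  functions near 0.
\<close>

lemma mean_less_imp_germ: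
  assumes "offspring_mean \<mu> < offspring_mean \<nu>" "1 < offspring_mean \<nu>"
  obtains \<epsilon> m where "0 < \<epsilon>" "\<epsilon> \<le> 1" "1 < m"
    "\<And>t. 0 \<le> t \<Longrightarrow> t \<le> \<epsilon> \<Longrightarrow> mark_prob \<mu> t \<le> mark_prob \<nu> t"
    "\<And>t. 0 \<le> t \<Longrightarrow> t \<le> \<epsilon> \<Longrightarrow> m * t \<le> mark_prob \<nu> t"
proof -
  have "max 1 (offspring_mean \<mu>) < offspring_mean \<nu>" using assms by simp
  then obtain r where r: "max 1 (offspring_mean \<mu>) < r" "r < offspring_mean \<nu>"
    using dense by blast
  then obtain m where m: "r = ennreal m" "0 \<le> m" by (cases r) auto
  have m1: "1 < m" using r(1) m by (simp flip: ennreal_1 add: ennreal_less_iff)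
  obtain \<epsilon> where \<epsilon>: "0 < \<epsilon>" "\<epsilon> \<le> 1" "\<And>t. 0 \<le> t \<Longrightarrow> t \<le> \<epsilon> \<Longrightarrow> m * t \<le> mark_prob \<nu> t"
    using mark_prob_ge_near_0[of m \<nu>] r(2) m by blast
  have "offspring_mean \<mu> \<le> ennreal m" using r(1) m(1) by (simp add: less_imp_le)
  then have "mark_prob \<mu> t \<le> mark_prob \<nu> t" if "0 \<le> t" "t \<le> \<epsilon>" for t
    using mark_prob_le_mean[of \<mu> m t] m(2) \<epsilon>(2) \<epsilon>(3)[OF that] that by linarith
  then show thesis using that[OF \<epsilon>(1,2) m1] \<epsilon>(3) by blast
qed

theorem corollary1p2:
  fixes P :: "'a::countable \<Rightarrow> 'a pmf"
  shows "\<forall>A :: 'a set. \<exists>l\<^sub>t l\<^sub>r :: ennreal.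
    1 \<le> l\<^sub>t \<and> 1 \<le> l\<^sub>r \<and> l\<^sub>t \<le> l\<^sub>r \<and>
    (\<forall>\<mu> :: nat pmf.
      (offspring_mean \<mu> < l\<^sub>t \<longrightarrow> transient_set P \<mu> A) \<and>
      (offspring_mean \<mu> > l\<^sub>t \<longrightarrow> \<not> transient_set P \<mu> A) \<and>
      (offspring_mean \<mu> < l\<^sub>r \<longrightarrow> \<not> recurrent_set P \<mu> A) \<and>
      (offspring_mean \<mu> > l\<^sub>r \<longrightarrow> recurrent_set P \<mu> A))"
proof
  fix A :: "'a set"
  define T where "T = {\<mu>. \<not> transient_set P \<mu> A}"
  define R where "R = {\<mu>. recurrent_set P \<mu> A}"
  define l\<^sub>t where "l\<^sub>t = (INF \<mu>\<in>T. offspring_mean \<mu>)"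
  define l\<^sub>r where "l\<^sub>r = (INF \<mu>\<in>R. offspring_mean \<mu>)"
  have "R \<subseteq> T"
    by (auto simp: R_def T_def recurrent_set_iff transient_set_iff) (metis less_irrefl)
  then have "l\<^sub>t \<le> l\<^sub>r"
    unfolding l\<^sub>t_def l\<^sub>r_def by (intro INF_superset_mono order_refl)
  have mean_ge_1: "1 \<le> offspring_mean \<mu>" if "\<mu> \<in> T" for \<mu>
  proof (rule ccontr)
    assume "\<not> 1 \<le> offspring_mean \<mu>"
    then have "infinite_visit_prob P \<mu> A x = 0" for x
      by (intro infinite_visit_prob_subcritical) simp
    then show False using that by (simp add: T_def transient_set_iff)
  qed
  then have "1 \<le> l\<^sub>t"
    unfolding l\<^sub>t_def by (rule INF_greatest)
  have below: "\<mu> \<notin> X" if "offspring_mean \<mu> < (INF \<mu>\<in>X. offspring_mean \<mu>)" for \<mu> X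
    using INF_lower[of \<mu> X offspring_mean] that leD by blast
  have above: "\<nu> \<in> X"
    if less: "(INF \<mu>\<in>X. offspring_mean \<mu>) < offspring_mean \<nu>" and "X \<subseteq> T"
      and mono: "\<And>\<mu> \<epsilon> m. \<lbrakk>\<mu> \<in> X; 0 < \<epsilon>; \<epsilon> \<le> 1; 1 < m;
        \<And>t. 0 \<le> t \<Longrightarrow> t \<le> \<epsilon> \<Longrightarrow> mark_prob \<mu> t \<le> mark_prob \<nu> t;
        \<And>t. 0 \<le> t \<Longrightarrow> t \<le> \<epsilon> \<Longrightarrow> m * t \<le> mark_prob \<nu> t\<rbrakk> \<Longrightarrow> \<nu> \<in> X" for \<nu> X
  proof -
    obtain \<mu> where \<mu>: "\<mu> \<in> X" "offspring_mean \<mu> < offspring_mean \<nu>"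
      using less unfolding INF_less_iff by blast
    moreover have "1 < offspring_mean \<nu>"
      using mean_ge_1 \<mu> \<open>X \<subseteq> T\<close> by (meson order_le_less_trans subsetD)
    ultimately show ?thesis
      using mean_less_imp_germ[of \<mu> \<nu>] mono[of \<mu>] by metis
  qed
  have "\<nu> \<in> T" if "l\<^sub>t < offspring_mean \<nu>" for \<nu>
    using that unfolding l\<^sub>t_def
  proof (rule above[OF _ order_refl])
    fix \<mu> \<epsilon> and m :: real
    assume "\<mu> \<in> T" and \<epsilon>: "0 < \<epsilon>" "\<epsilon> \<le> 1"
      and germ: "\<And>t. 0 \<le> t \<Longrightarrow> t \<le> \<epsilon> \<Longrightarrow> mark_prob \<mu> t \<le> mark_prob \<nu> t"
    have "transient_set P \<nu> A \<Longrightarrow> transient_set P \<mu> A"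
      by (rule transient_set_antimono[OF \<epsilon> germ])
    with \<open>\<mu> \<in> T\<close> show "\<nu> \<in> T" unfolding T_def by blast
  qed
  moreover have "\<nu> \<in> R" if "l\<^sub>r < offspring_mean \<nu>" for \<nu>
    using that unfolding l\<^sub>r_def
  proof (rule above[OF _ \<open>R \<subseteq> T\<close>])
    fix \<mu> \<epsilon> and m :: real
    assume "\<mu> \<in> R" and \<epsilon>: "0 < \<epsilon>" "\<epsilon> \<le> 1" "1 < m"
      and germ: "\<And>t. 0 \<le> t \<Longrightarrow> t \<le> \<epsilon> \<Longrightarrow> mark_prob \<mu> t \<le> mark_prob \<nu> t"
        "\<And>t. 0 \<le> t \<Longrightarrow> t \<le> \<epsilon> \<Longrightarrow> m * t \<le> mark_prob \<nu> t"
    have "recurrent_set P \<mu> A \<Longrightarrow> recurrent_set P \<nu> A"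
      by (rule recurrent_set_mono[OF \<epsilon>(1,2) germ(1) \<epsilon>(3) germ(2)])
    with \<open>\<mu> \<in> R\<close> show "\<nu> \<in> R" unfolding R_def by blast
  qed
  moreover have "\<mu> \<notin> T" if "offspring_mean \<mu> < l\<^sub>t" for \<mu>
    using that unfolding l\<^sub>t_def by (rule below)
  moreover have "\<mu> \<notin> R" if "offspring_mean \<mu> < l\<^sub>r" for \<mu>
    using that unfolding l\<^sub>r_def by (rule below)
  moreover have "1 \<le> l\<^sub>r" using \<open>1 \<le> l\<^sub>t\<close> \<open>l\<^sub>t \<le> l\<^sub>r\<close> by (rule order_trans)
  ultimately show "\<exists>l\<^sub>t l\<^sub>r :: ennreal.
    1 \<le> l\<^sub>t \<and> 1 \<le> l\<^sub>r \<and> l\<^sub>t \<le> l\<^sub>r \<and>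
    (\<forall>\<mu> :: nat pmf.
      (offspring_mean \<mu> < l\<^sub>t \<longrightarrow> transient_set P \<mu> A) \<and>
      (offspring_mean \<mu> > l\<^sub>t \<longrightarrow> \<not> transient_set P \<mu> A) \<and>
      (offspring_mean \<mu> < l\<^sub>r \<longrightarrow> \<not> recurrent_set P \<mu> A) \<and>
      (offspring_mean \<mu> > l\<^sub>r \<longrightarrow> recurrent_set P \<mu> A))"
    using \<open>1 \<le> l\<^sub>t\<close> \<open>l\<^sub>t \<le> l\<^sub>r\<close> unfolding T_def R_def by blast
qed

end
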